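(* Min-Makespan CMP can be solved in $\mathcal{O}(1)$ time for two robots.
   Context: Robots are axis-parallel unit squares in $\mathbb{R}^2$: a robot at position $p$ occupies $p+\boxdot$, $\boxdot=\{q:\|q\|_\infty\le 1/2\}$. Distances are measured in the $L_1$ norm $\|p\|=|x(p)|+|y(p)|$. A configuration of $k$ robots is a tuple $(p_1,\dots,p_k)$ with $\|p_i-p_j\|_\infty\ge 1$ for $i\ne j$; $\mathcal{F}_k$ is the set of configurations. A trajectory over $T=[t_0,t_1]$ is a $1$-Lipschitz (w.r.t. $L_1$) map $m:T\to\mathbb{R}^2$ whose image is a polygonal chain; a schedule is a tuple $M=(m_1,\dots,m_k)$ of trajectories over $T$, feasible if $M(t)\in\mathcal{F}_k$ for all $t\in T$; its makespan is $t_1-t_0$. Min-Makespan CMP: given $A,B\in\mathcal{F}_k$, find the minimum makespan of a feasible schedule from $A$ to $B$ (and such a schedule). *)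

theory Defs
  imports "HOL-Analysis.Analysis"
begin

type_synonym point = "real \<times> real"

definition l1 :: "point \<Rightarrow> real" where
  "l1 p = \<bar>fst p\<bar> + \<bar>snd p\<bar>"

definition linf :: "point \<Rightarrow> real" where
  "linf p = max \<bar>fst p\<bar> \<bar>snd p\<bar>"

text \<open>Configurations of k robots: tuples (lists of length k) of positions whose
  unit squares have disjoint interiors.\<close>
definition configs :: "nat \<Rightarrow> point list set" where
  "configs k = {P. length P = k \<and>
     (\<forall>i<k. \<forall>j<k. i \<noteq> j \<longrightarrow> linf (P ! i - P ! j) \<ge> 1)}"

definition polygonal_chain :: "point set \<Rightarrow> bool" where
  "polygonal_chain S \<longleftrightarrow> (\<exists>qs. qs \<noteq> [] \<and>
     S = {qs ! 0} \<union> (\<Union>i<length qs - 1. closed_segment (qs ! i) (qs ! Suc i)))"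

definition trajectory :: "real \<Rightarrow> real \<Rightarrow> (real \<Rightarrow> point) \<Rightarrow> bool" where
  "trajectory t0 t1 m \<longleftrightarrow>
     (\<forall>s\<in>{t0..t1}. \<forall>t\<in>{t0..t1}. l1 (m s - m t) \<le> \<bar>s - t\<bar>) \<and>
     polygonal_chain (m ` {t0..t1})"

definition feasible_schedule ::
  "(real \<Rightarrow> point) list \<Rightarrow> real \<Rightarrow> real \<Rightarrow> point list \<Rightarrow> point list \<Rightarrow> bool" where
  "feasible_schedule M t0 t1 A B \<longleftrightarrow>
     t0 \<le> t1 \<and> length A = length M \<and> length B = length M \<and>
     (\<forall>m\<in>set M. trajectory t0 t1 m) \<and>
     (\<forall>t\<in>{t0..t1}. map (\<lambda>m. m t) M \<in> configs (length M)) \<and>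
     map (\<lambda>m. m t0) M = A \<and> map (\<lambda>m. m t1) M = B"

datatype rexpr = Inp nat | Const int | Add rexpr rexpr | Sub rexpr rexpr
  | Mul rexpr rexpr | Div rexpr rexpr

fun eval_rexpr :: "real list \<Rightarrow> rexpr \<Rightarrow> real option" where
  "eval_rexpr xs (Inp i) = (if i < length xs then Some (xs ! i) else None)"
| "eval_rexpr xs (Const c) = Some (of_int c)"
| "eval_rexpr xs (Add a b) =
     (case (eval_rexpr xs a, eval_rexpr xs b) of (Some x, Some y) \<Rightarrow> Some (x + y) | _ \<Rightarrow> None)"
| "eval_rexpr xs (Sub a b) =
     (case (eval_rexpr xs a, eval_rexpr xs b) of (Some x, Some y) \<Rightarrow> Some (x - y) | _ \<Rightarrow> None)"
| "eval_rexpr xs (Mul a b) =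
     (case (eval_rexpr xs a, eval_rexpr xs b) of (Some x, Some y) \<Rightarrow> Some (x * y) | _ \<Rightarrow> None)"
| "eval_rexpr xs (Div a b) =
     (case (eval_rexpr xs a, eval_rexpr xs b) of
        (Some x, Some y) \<Rightarrow> (if y = 0 then None else Some (x / y)) | _ \<Rightarrow> None)"

text \<open>A (finite, fixed) algebraic computation tree: branch on comparisons,
  output a list of computed reals at a leaf.  A fixed finite tree performs a
  number of operations bounded independently of the input, i.e. O(1) time.\<close>
datatype ctree = Leaf "rexpr list" | Le rexpr rexpr ctree ctree

fun eval_ctree :: "real list \<Rightarrow> ctree \<Rightarrow> real list option" where
  "eval_ctree xs (Leaf es) =
     (let vs = map (eval_rexpr xs) es in
      if None \<in> set vs then None else Some (map the vs))"
| "eval_ctree xs (Le a b l r) =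
     (case (eval_rexpr xs a, eval_rexpr xs b) of
        (Some x, Some y) \<Rightarrow> (if x \<le> y then eval_ctree xs l else eval_ctree xs r)
      | _ \<Rightarrow> None)"

definition encode2 :: "point list \<Rightarrow> point list \<Rightarrow> real list" where
  "encode2 A B = concat (map (\<lambda>p. [fst p, snd p]) (A @ B))"

fun waypoints2 :: "real list \<Rightarrow> (real \<times> point \<times> point) list" where
  "waypoints2 (t # x1 # y1 # x2 # y2 # rest) = (t, (x1, y1), (x2, y2)) # waypoints2 rest"
| "waypoints2 _ = []"

fun interp :: "(real \<times> point) list \<Rightarrow> real \<Rightarrow> point" where
  "interp [] t = 0"
| "interp [(s, p)] t = p"
| "interp ((s, p) # (s', p') # rest) t =
     (if t \<le> s' then p + ((t - s) / (s' - s)) *\<^sub>R (p' - p)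
      else interp ((s', p') # rest) t)"

text \<open>The schedule described by an output list  tau # waypoints.\<close>
definition out_schedule :: "real list \<Rightarrow> (real \<Rightarrow> point) list" where
  "out_schedule out =
     (let ws = waypoints2 (tl out) in
      [interp (map (\<lambda>(t, p, q). (t, p)) ws), interp (map (\<lambda>(t, p, q). (t, q)) ws)])"

definition out_t0 :: "real list \<Rightarrow> real" where
  "out_t0 out = fst (hd (waypoints2 (tl out)))"

definition out_t1 :: "real list \<Rightarrow> real" where
  "out_t1 out = fst (last (waypoints2 (tl out)))"

definition solves_minmakespan2 :: "ctree \<Rightarrow> bool" where
  "solves_minmakespan2 T \<longleftrightarrow>
     (\<forall>A\<in>configs 2. \<forall>B\<in>configs 2. \<exists>out.
        eval_ctree (encode2 A B) T = Some out \<and> out \<noteq> [] \<and>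
        waypoints2 (tl out) \<noteq> [] \<and>
        feasible_schedule (out_schedule out) (out_t0 out) (out_t1 out) A B \<and>
        hd out = out_t1 out - out_t0 out \<and>
        (\<forall>M t0 t1. feasible_schedule M t0 t1 A B \<longrightarrow> hd out \<le> t1 - t0))"

end

theory Submission
  imports Defs
begin

text \<open>The relative position of the two robots ranges over the union of four closed half-planes. Cutting
  a feasible schedule at the last time it visits each half-plane yields at most four pieces whose
  endpoints lie in a common half-plane; since half-planes are convex, every piece can be replaced by
  simultaneous linear motion without changing its duration. Hence the optimal makespan is the minimum over
  the finitely many sequences of four half-planes of a linear program with fixed rational coefficients
  in which the input enters as parameters. Fourier--Motzkin elimination solves such a program by a
  bounded number of arithmetic operations and comparisons, that is, by a computation tree.\<close>


section \<open>Functions computed by algebraic computation trees\<close>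

text \<open>A tree of fixed size suffices because a half-plane is dropped for good after its last
  visit: however often a schedule changes sides, three intermediate waypoints are enough to match
  its makespan. The half-plane in force on each piece is the only choice that is not linear. Once
  all four are fixed, the signs of the coefficients are known in advance, so elimination never
  branches on a coefficient and never divides by a number computed from the input. Three obstacles
  shape the rest. A minimum is needed, not an infimum: all inequalities are nonstrict and the
  makespan is at least 0, so the least feasible value is attained as a largest lower bound. Some
  plan must exist for every pair of configurations, since the computed output means nothing for an
  infeasible program; an explicit detour provides one. Finally, cutting a schedule can produce
  pieces of length zero, so waypoint times may coincide and the convention \<open>x / 0 = 0\<close>
  must be harmless in \<open>interp\<close>.\<close>

primrec bind_tree :: "ctree \<Rightarrow> (rexpr list \<Rightarrow> ctree) \<Rightarrow> ctree" where
  "bind_tree (Leaf es) k = k es"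
| "bind_tree (Le a b l r) k = Le a b (bind_tree l k) (bind_tree r k)"

lemma eval_Leaf_eq_Some_iff:
  "eval_ctree xs (Leaf es) = Some ys \<longleftrightarrow> map (eval_rexpr xs) es = map Some ys"
proof -
  have "vs = map Some (map the vs)" if "None \<notin> set vs" for vs :: "real option list"
    using that by (induction vs) auto
  then have "None \<notin> set vs \<and> map the vs = ys \<longleftrightarrow> vs = map Some ys" for vs
    by (auto simp: comp_def)
  from this[of "map (eval_rexpr xs) es"] show ?thesis
    by (auto simp: Let_def simp del: map_map)
qed

text \<open>The continuation receives the expressions of the leaf that is reached, not numbers: a
  tree has no storage, so a later stage can use an earlier result only by evaluating its expression
  again.\<close>

lemma eval_bind_tree:
  assumes "eval_ctree xs T = Some ys"
    and "\<And>es. map (eval_rexpr xs) es = map Some ys \<Longrightarrow> eval_ctree xs (k es) = r"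
  shows "eval_ctree xs (bind_tree T k) = r"
  using assms
proof (induction T)
  case (Leaf es)
  then show ?case by (simp add: eval_Leaf_eq_Some_iff del: eval_ctree.simps)
next
  case (Le a b T1 T2)
  then show ?case by (auto split: option.splits if_splits)
qed

text \<open>One tree serves all inputs of length \<open>n\<close>, which is the uniform bound on the
  number of operations; evaluation must succeed on each of them.\<close>

definition computable :: "nat \<Rightarrow> (real list \<Rightarrow> real list) \<Rightarrow> bool" where
  "computable n f \<longleftrightarrow> (\<exists>T. \<forall>xs. length xs = n \<longrightarrow> eval_ctree xs T = Some (f xs))"

abbreviation real_computable :: "nat \<Rightarrow> (real list \<Rightarrow> real) \<Rightarrow> bool" where
  "real_computable n f \<equiv> computable n (\<lambda>xs. [f xs])"

lemma computableI:
  assumes "\<And>xs. length xs = n \<Longrightarrow> eval_ctree xs T = Some (f xs)"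
  shows "computable n f"
  using assms unfolding computable_def by blast

lemma computableE:
  assumes "computable n f"
  obtains T where "\<And>xs. length xs = n \<Longrightarrow> eval_ctree xs T = Some (f xs)"
  using assms unfolding computable_def by blast

lemma computable_cong:
  assumes "computable n f" "\<And>xs. length xs = n \<Longrightarrow> f xs = g xs"
  shows "computable n g"
  using assms unfolding computable_def by simp

lemma computable_Nil: "computable n (\<lambda>xs. [])"
  by (rule computableI[where T = "Leaf []"]) simp

lemma computable_append:
  assumes "computable n f" "computable n g"
  shows "computable n (\<lambda>xs. f xs @ g xs)"
proof -
  obtain F G where F: "\<And>xs. length xs = n \<Longrightarrow> eval_ctree xs F = Some (f xs)"
    and G: "\<And>xs. length xs = n \<Longrightarrow> eval_ctree xs G = Some (g xs)"
    using assms by (auto elim!: computableE)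
  show ?thesis
    by (rule computableI[where T = "bind_tree F (\<lambda>es. bind_tree G (\<lambda>es'. Leaf (es @ es')))"],
        rule eval_bind_tree[OF F], assumption, rule eval_bind_tree[OF G], assumption)
      (simp add: eval_Leaf_eq_Some_iff del: eval_ctree.simps)
qed

lemma computable_if_le:
  assumes "real_computable n a" "real_computable n b" "computable n f" "computable n g"
  shows "computable n (\<lambda>xs. if a xs \<le> b xs then f xs else g xs)"
proof -
  obtain A B F G where A: "\<And>xs. length xs = n \<Longrightarrow> eval_ctree xs A = Some [a xs]"
    and B: "\<And>xs. length xs = n \<Longrightarrow> eval_ctree xs B = Some [b xs]"
    and F: "\<And>xs. length xs = n \<Longrightarrow> eval_ctree xs F = Some (f xs)"
    and G: "\<And>xs. length xs = n \<Longrightarrow> eval_ctree xs G = Some (g xs)"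
    using assms by (auto elim!: computableE)
  show ?thesis
    by (rule computableI[where T = "bind_tree A (\<lambda>es. bind_tree B (\<lambda>es'. Le (hd es) (hd es') F G))"],
        rule eval_bind_tree[OF A], assumption, rule eval_bind_tree[OF B], assumption)
      (auto simp: F G)
qed

lemma real_computable_binop:
  assumes "real_computable n f" "real_computable n g"
    and "\<And>xs a b. length xs = n \<Longrightarrow> eval_rexpr xs a = Some (f xs) \<Longrightarrow> eval_rexpr xs b = Some (g xs)
      \<Longrightarrow> eval_rexpr xs (c a b) = Some (h xs)"
  shows "real_computable n h"
proof -
  obtain F G where F: "\<And>xs. length xs = n \<Longrightarrow> eval_ctree xs F = Some [f xs]"
    and G: "\<And>xs. length xs = n \<Longrightarrow> eval_ctree xs G = Some [g xs]"
    using assms by (auto elim!: computableE)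
  show ?thesis
    by (rule computableI[where T = "bind_tree F (\<lambda>es. bind_tree G (\<lambda>es'. Leaf [c (hd es) (hd es')]))"],
        rule eval_bind_tree[OF F], assumption, rule eval_bind_tree[OF G], assumption)
      (auto simp: eval_Leaf_eq_Some_iff assms simp del: eval_ctree.simps)
qed

lemma real_computable_add:
  "real_computable n f \<Longrightarrow> real_computable n g \<Longrightarrow> real_computable n (\<lambda>xs. f xs + g xs)"
  by (rule real_computable_binop[of n f g Add]) auto

lemma real_computable_mult:
  "real_computable n f \<Longrightarrow> real_computable n g \<Longrightarrow> real_computable n (\<lambda>xs. f xs * g xs)"
  by (rule real_computable_binop[of n f g Mul]) auto

lemma real_computable_nth: "i < n \<Longrightarrow> real_computable n (\<lambda>xs. xs ! i)"
  by (rule computableI[where T = "Leaf [Inp i]"]) simp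

text \<open>The constants of \<open>rexpr\<close> are integers, so a rational is entered as a
  quotient with a constant nonzero denominator, and the division cannot fail.\<close>

lemma real_computable_Rats:
  assumes "q \<in> \<rat>"
  shows "real_computable n (\<lambda>_. q)"
proof -
  obtain a b where "q = of_int a / of_int b" "b \<noteq> 0"
    using assms by (rule Rats_cases') auto
  then show ?thesis
    by (intro computableI[where T = "Leaf [Div (Const a) (Const b)]"]) simp
qed

lemma computable_map:
  assumes "\<And>f. f \<in> set fs \<Longrightarrow> real_computable n f"
  shows "computable n (\<lambda>xs. map (\<lambda>f. f xs) fs)"
  using assms
proof (induction fs)
  case Nil
  then show ?case by (simp add: computable_Nil)
next
  case (Cons f fs)
  then show ?case using computable_append[of n "\<lambda>xs. [f xs]" "\<lambda>xs. map (\<lambda>f. f xs) fs"] by simp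
qed

text \<open>An out-of-range input is replaced by an expression that has no value either.\<close>
primrec subst_rexpr :: "rexpr list \<Rightarrow> rexpr \<Rightarrow> rexpr" where
  "subst_rexpr es (Inp i) = (if i < length es then es ! i else Div (Const 0) (Const 0))"
| "subst_rexpr es (Const c) = Const c"
| "subst_rexpr es (Add a b) = Add (subst_rexpr es a) (subst_rexpr es b)"
| "subst_rexpr es (Sub a b) = Sub (subst_rexpr es a) (subst_rexpr es b)"
| "subst_rexpr es (Mul a b) = Mul (subst_rexpr es a) (subst_rexpr es b)"
| "subst_rexpr es (Div a b) = Div (subst_rexpr es a) (subst_rexpr es b)"

primrec subst_ctree :: "rexpr list \<Rightarrow> ctree \<Rightarrow> ctree" where
  "subst_ctree es (Leaf as) = Leaf (map (subst_rexpr es) as)"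
| "subst_ctree es (Le a b l r) =
     Le (subst_rexpr es a) (subst_rexpr es b) (subst_ctree es l) (subst_ctree es r)"

lemma eval_subst_rexpr:
  assumes "map (eval_rexpr xs) es = map Some ys"
  shows "eval_rexpr xs (subst_rexpr es e) = eval_rexpr ys e"
proof (induction e)
  case (Inp i)
  have "length es = length ys" using assms by (metis length_map)
  moreover have "eval_rexpr xs (es ! i) = Some (ys ! i)" if "i < length es"
    using assms that calculation by (metis nth_map)
  ultimately show ?case by simp
qed simp_all

lemma eval_subst_ctree:
  assumes "map (eval_rexpr xs) es = map Some ys"
  shows "eval_ctree xs (subst_ctree es T) = eval_ctree ys T"
proof (induction T)
  case (Leaf as)
  have "map (eval_rexpr xs) (map (subst_rexpr es) as) = map (eval_rexpr ys) as"
    using eval_subst_rexpr[OF assms] by simp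
  then show ?case by (simp only: subst_ctree.simps eval_ctree.simps)
next
  case (Le a b T1 T2)
  then show ?case using eval_subst_rexpr[OF assms] by (simp split: option.split)
qed

text \<open>The leaf expressions of the first tree are substituted for the inputs of the second, in
  its comparisons as well as in its leaves.\<close>

lemma computable_compose:
  assumes "computable n f" "\<And>xs. length xs = n \<Longrightarrow> length (f xs) = m" "computable m g"
  shows "computable n (\<lambda>xs. g (f xs))"
proof -
  obtain F G where F: "\<And>xs. length xs = n \<Longrightarrow> eval_ctree xs F = Some (f xs)"
    and G: "\<And>ys. length ys = m \<Longrightarrow> eval_ctree ys G = Some (g ys)"
    using assms(1,3) by (auto elim!: computableE)
  show ?thesis
    by (rule computableI[where T = "bind_tree F (\<lambda>es. subst_ctree es G)"],
        rule eval_bind_tree[OF F], assumption)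
      (simp add: eval_subst_ctree G assms(2))
qed

lemma computable_id: "computable n (\<lambda>xs. xs)"
  by (rule computable_cong[OF computable_map[of "map (\<lambda>i xs. xs ! i) [0..<n]"]])
    (auto simp: real_computable_nth comp_def intro!: nth_equalityI)

lemma real_computable_Max:
  assumes "finite S" "S \<noteq> {}" "\<And>f. f \<in> S \<Longrightarrow> real_computable n (h f)"
  shows "real_computable n (\<lambda>xs. Max ((\<lambda>f. h f xs) ` S))"
  using assms
proof (induction S rule: finite_ne_induct)
  case (singleton f)
  then show ?case by simp
next
  case (insert f S)
  let ?M = "\<lambda>xs. Max ((\<lambda>f. h f xs) ` S)"
  have f: "real_computable n (h f)" and M: "real_computable n ?M"
    using insert by auto
  show ?case
    by (rule computable_cong[OF computable_if_le[OF f M M f]]) (use insert.hyps in \<open>simp add: max_def\<close>)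
qed

definition decidable :: "nat \<Rightarrow> (real list \<Rightarrow> bool) \<Rightarrow> bool" where
  "decidable n P \<longleftrightarrow> real_computable n (\<lambda>xs. if P xs then 1 else 0)"

lemma decidable_cong:
  assumes "decidable n P" "\<And>xs. length xs = n \<Longrightarrow> P xs \<longleftrightarrow> Q xs"
  shows "decidable n Q"
  using assms(1) unfolding decidable_def by (rule computable_cong) (simp add: assms(2))

text \<open>A decided predicate has the value 0 or 1, so a single comparison with 1 performs the
  branching.\<close>

lemma computable_if:
  assumes "decidable n P" "computable n f" "computable n g"
  shows "computable n (\<lambda>xs. if P xs then f xs else g xs)"
  by (rule computable_cong[OF computable_if_le[OF _ assms(1)[unfolded decidable_def] assms(2,3), of "\<lambda>_. 1"]])
    (simp_all add: real_computable_Rats)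

lemma decidable_const: "decidable n (\<lambda>_. b)"
  unfolding decidable_def by (cases b) (simp_all add: real_computable_Rats)

lemma decidable_le:
  assumes "real_computable n f" "real_computable n g"
  shows "decidable n (\<lambda>xs. f xs \<le> g xs)"
  unfolding decidable_def
  by (rule computable_cong[OF computable_if_le[OF assms, of "\<lambda>_. [1]" "\<lambda>_. [0]"]])
    (simp_all add: real_computable_Rats)

lemma decidable_conj:
  assumes "decidable n P" "decidable n Q"
  shows "decidable n (\<lambda>xs. P xs \<and> Q xs)"
  unfolding decidable_def
  by (rule computable_cong[OF computable_if[OF assms(1) assms(2)[unfolded decidable_def], of "\<lambda>_. [0]"]])
    (simp_all add: real_computable_Rats)

lemma decidable_not:
  assumes "decidable n P"
  shows "decidable n (\<lambda>xs. \<not> P xs)"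
  unfolding decidable_def
  by (rule computable_cong[OF computable_if[OF assms, of "\<lambda>_. [0]" "\<lambda>_. [1]"]])
    (simp_all add: real_computable_Rats)

lemma decidable_disj:
  assumes "decidable n P" "decidable n Q"
  shows "decidable n (\<lambda>xs. P xs \<or> Q xs)"
  using decidable_not[OF decidable_conj[OF decidable_not[OF assms(1)] decidable_not[OF assms(2)]]]
  by simp

lemma decidable_Ball:
  assumes "finite S" "\<And>s. s \<in> S \<Longrightarrow> decidable n (P s)"
  shows "decidable n (\<lambda>xs. \<forall>s\<in>S. P s xs)"
  using assms by (induction S rule: finite_induct) (simp_all add: decidable_const decidable_conj)


section \<open>Fourier--Motzkin elimination\<close>

text \<open>Elimination divides by coefficients, so they should lie in a field; they must also be
  expressible in a tree. The rationals meet both demands.\<close>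

definition rational_affine :: "nat \<Rightarrow> (real list \<Rightarrow> real) \<Rightarrow> bool" where
  "rational_affine n f \<longleftrightarrow> (\<exists>c k. (\<forall>i. c i \<in> \<rat>) \<and> k \<in> \<rat> \<and>
     (\<forall>xs. length xs = n \<longrightarrow> f xs = (\<Sum>i<n. c i * xs ! i) + k))"

lemma rational_affineE:
  assumes "rational_affine n f"
  obtains c k where "\<And>i. c i \<in> \<rat>" "k \<in> \<rat>"
    "\<And>xs. length xs = n \<Longrightarrow> f xs = (\<Sum>i<n. c i * xs ! i) + k"
  using assms unfolding rational_affine_def by blast

lemma rational_affine_const: "k \<in> \<rat> \<Longrightarrow> rational_affine n (\<lambda>_. k)"
  unfolding rational_affine_def by (intro exI[of _ "\<lambda>_. 0"] exI[of _ k]) simp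

lemma rational_affine_nth: "i < n \<Longrightarrow> rational_affine n (\<lambda>xs. xs ! i)"
  unfolding rational_affine_def
  by (intro exI[of _ "\<lambda>j. if j = i then 1 else 0"] exI[of _ 0]) (simp add: sum.delta if_distrib[of "\<lambda>c. c * _"] cong: if_cong)

lemma rational_affine_add:
  assumes "rational_affine n f" "rational_affine n g"
  shows "rational_affine n (\<lambda>xs. f xs + g xs)"
  using assms(1)
proof (rule rational_affineE)
  fix c k assume f: "\<And>i. c i \<in> \<rat>" "k \<in> \<rat>"
    "\<And>xs. length xs = n \<Longrightarrow> f xs = (\<Sum>i<n. c i * xs ! i) + k"
  from assms(2) show ?thesis
  proof (rule rational_affineE)
    fix d l assume g: "\<And>i. d i \<in> \<rat>" "l \<in> \<rat>"
      "\<And>xs. length xs = n \<Longrightarrow> g xs = (\<Sum>i<n. d i * xs ! i) + l"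
    show ?thesis unfolding rational_affine_def
      by (intro exI[of _ "\<lambda>i. c i + d i"] exI[of _ "k + l"]) (simp add: f g sum.distrib distrib_right)
  qed
qed

lemma rational_affine_cmult:
  assumes "q \<in> \<rat>" "rational_affine n f"
  shows "rational_affine n (\<lambda>xs. q * f xs)"
  using assms(2)
proof (rule rational_affineE)
  fix c k assume "\<And>i. c i \<in> \<rat>" "k \<in> \<rat>"
    "\<And>xs. length xs = n \<Longrightarrow> f xs = (\<Sum>i<n. c i * xs ! i) + k"
  then show ?thesis unfolding rational_affine_def using assms(1)
    by (intro exI[of _ "\<lambda>i. q * c i"] exI[of _ "q * k"]) (simp add: sum_distrib_left distrib_left mult.assoc)
qed

lemma rational_affine_diff:
  assumes "rational_affine n f" "rational_affine n g"
  shows "rational_affine n (\<lambda>xs. f xs - g xs)"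
  using rational_affine_add[OF assms(1) rational_affine_cmult[OF _ assms(2), of "-1"]] by simp

lemma real_computable_rational_affine:
  assumes "rational_affine n f"
  shows "real_computable n f"
proof -
  obtain c k where c: "\<And>i. c i \<in> \<rat>" and k: "k \<in> \<rat>"
    and f: "\<And>xs. length xs = n \<Longrightarrow> f xs = (\<Sum>i<n. c i * xs ! i) + k"
    using assms by (rule rational_affineE) blast
  have "real_computable n (\<lambda>xs. \<Sum>i<m. c i * xs ! i)" if "m \<le> n" for m
    using that
  proof (induction m)
    case 0
    then show ?case by (simp add: real_computable_Rats)
  next
    case (Suc m)
    then show ?case
      by (simp add: real_computable_add real_computable_mult real_computable_nth real_computable_Rats c)
  qed
  then have "real_computable n (\<lambda>xs. (\<Sum>i<n. c i * xs ! i) + k)"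
    by (intro real_computable_add real_computable_Rats k) simp
  then show ?thesis by (rule computable_cong) (simp add: f)
qed

lemma rational_affine_Suc:
  assumes "rational_affine (Suc n) f"
  obtains g c where "rational_affine n g" "c \<in> \<rat>"
    "\<And>xs y. length xs = n \<Longrightarrow> f (xs @ [y]) = g xs + c * y"
proof -
  obtain c k where c: "\<And>i. c i \<in> \<rat>" and k: "k \<in> \<rat>"
    and f: "\<And>xs. length xs = Suc n \<Longrightarrow> f xs = (\<Sum>i<Suc n. c i * xs ! i) + k"
    using assms by (rule rational_affineE) blast
  have "rational_affine n (\<lambda>xs. (\<Sum>i<n. c i * xs ! i) + k)"
    unfolding rational_affine_def using c k by blast
  moreover have "f (xs @ [y]) = ((\<Sum>i<n. c i * xs ! i) + k) + c n * y" if "length xs = n" for xs y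
    using that by (simp add: f nth_append)
  ultimately show thesis using that c by blast
qed

section \<open>Systems of linear inequalities and elimination of variables\<close>

definition polyhedral :: "nat \<Rightarrow> (real list \<Rightarrow> bool) \<Rightarrow> bool" where
  "polyhedral n P \<longleftrightarrow> (\<exists>L. finite L \<and> (\<forall>f\<in>L. rational_affine n f) \<and>
     (\<forall>xs. length xs = n \<longrightarrow> (P xs \<longleftrightarrow> (\<forall>f\<in>L. f xs \<le> 0))))"

lemma polyhedral_cong:
  assumes "polyhedral n P" "\<And>xs. length xs = n \<Longrightarrow> P xs \<longleftrightarrow> Q xs"
  shows "polyhedral n Q"
  using assms unfolding polyhedral_def by simp

lemma polyhedral_le:
  assumes "rational_affine n f" "rational_affine n g"
  shows "polyhedral n (\<lambda>xs. f xs \<le> g xs)"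
  unfolding polyhedral_def
  by (rule exI[of _ "{\<lambda>xs. f xs - g xs}"]) (simp add: rational_affine_diff assms)

lemma polyhedral_conj:
  assumes "polyhedral n P" "polyhedral n Q"
  shows "polyhedral n (\<lambda>xs. P xs \<and> Q xs)"
proof -
  obtain L where "finite L" "\<forall>f\<in>L. rational_affine n f" "\<forall>xs. length xs = n \<longrightarrow> (P xs \<longleftrightarrow> (\<forall>f\<in>L. f xs \<le> 0))"
    using assms(1) unfolding polyhedral_def by blast
  moreover obtain K where "finite K" "\<forall>f\<in>K. rational_affine n f" "\<forall>xs. length xs = n \<longrightarrow> (Q xs \<longleftrightarrow> (\<forall>f\<in>K. f xs \<le> 0))"
    using assms(2) unfolding polyhedral_def by blast
  ultimately show ?thesis unfolding polyhedral_def by (intro exI[of _ "L \<union> K"]) auto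
qed

lemma polyhedral_Ball:
  assumes "finite S" "\<And>s. s \<in> S \<Longrightarrow> polyhedral n (P s)"
  shows "polyhedral n (\<lambda>xs. \<forall>s\<in>S. P s xs)"
  using assms
proof (induction S rule: finite_induct)
  case empty
  show ?case unfolding polyhedral_def by (rule exI[of _ "{}"]) simp
qed (simp add: polyhedral_conj)

lemma decidable_polyhedral:
  assumes "polyhedral n P"
  shows "decidable n P"
proof -
  obtain L where "finite L" "\<And>f. f \<in> L \<Longrightarrow> rational_affine n f"
    and P: "\<And>xs. length xs = n \<Longrightarrow> (P xs \<longleftrightarrow> (\<forall>f\<in>L. f xs \<le> 0))"
    using assms unfolding polyhedral_def by metis
  then have "decidable n (\<lambda>xs. \<forall>f\<in>L. f xs \<le> 0)"
    by (intro decidable_Ball decidable_le real_computable_rational_affine rational_affine_const) auto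
  then show ?thesis by (rule decidable_cong) (simp add: P)
qed

text \<open>One Fourier--Motzkin step for the last variable \<open>y\<close>. Each inequality bounds
  \<open>y\<close> from below, from above or not at all, according to the sign of its coefficient; a
  solution exists iff every lower bound is at most every upper bound. The witness \<open>w\<close>
  is the largest lower bound if there is one, hence the least solution. Without lower bounds the
  solutions, if any, are unbounded below, which the hypothesis \<open>0 \<le> y\<close> of the last
  claim excludes.\<close>

lemma polyhedral_eliminate:
  assumes "polyhedral (Suc n) P"
  obtains w where "polyhedral n (\<lambda>xs. \<exists>y. P (xs @ [y]))" "real_computable n w"
    "\<And>xs. length xs = n \<Longrightarrow> \<exists>y. P (xs @ [y]) \<Longrightarrow> P (xs @ [w xs])"
    "\<And>xs y. length xs = n \<Longrightarrow> (\<And>y. P (xs @ [y]) \<Longrightarrow> 0 \<le> y) \<Longrightarrow> P (xs @ [y]) \<Longrightarrow> w xs \<le> y"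
proof -
  obtain L where fin: "finite L" and aff: "\<And>f. f \<in> L \<Longrightarrow> rational_affine (Suc n) f"
    and P: "\<And>xs. length xs = Suc n \<Longrightarrow> (P xs \<longleftrightarrow> (\<forall>f\<in>L. f xs \<le> 0))"
    using assms unfolding polyhedral_def by metis
  have "\<forall>f\<in>L. \<exists>g c. rational_affine n g \<and> c \<in> \<rat> \<and>
    (\<forall>xs y. length xs = n \<longrightarrow> f (xs @ [y]) = g xs + c * y)"
    using aff by (metis rational_affine_Suc)
  then obtain g c where g: "\<And>f. f \<in> L \<Longrightarrow> rational_affine n (g f)"
    and c: "\<And>f. f \<in> L \<Longrightarrow> c f \<in> \<rat>"
    and f: "\<And>f xs y. f \<in> L \<Longrightarrow> length xs = n \<Longrightarrow> f (xs @ [y]) = g f xs + c f * y"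
    by metis
  \<comment> \<open>The value of \<open>y\<close> at which \<open>f\<close> vanishes, for a nonzero
    coefficient \<open>c f\<close>.\<close>
  define b where "b f xs = (- 1 / c f) * g f xs" for f xs
  have b: "rational_affine n (b f)" if "f \<in> L" for f
    unfolding b_def using that by (intro rational_affine_cmult g) (simp_all add: c)
  define Lo Up Ze where "Lo = {f\<in>L. c f < 0}" and "Up = {f\<in>L. c f > 0}" and "Ze = {f\<in>L. c f = 0}"
  have sub: "Lo \<subseteq> L" "Up \<subseteq> L" "Ze \<subseteq> L" "L = Lo \<union> Up \<union> Ze"
    by (auto simp: Lo_def Up_def Ze_def)
  have fins: "finite Lo" "finite Up" "finite Ze"
    using sub(1-3) fin by (auto intro: finite_subset)
  have P_iff: "P (xs @ [y]) \<longleftrightarrow>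
      (\<forall>f\<in>Ze. g f xs \<le> 0) \<and> (\<forall>f\<in>Lo. b f xs \<le> y) \<and> (\<forall>f\<in>Up. y \<le> b f xs)"
    if "length xs = n" for xs y
  proof -
    have "f (xs @ [y]) \<le> 0 \<longleftrightarrow> b f xs \<le> y" if "f \<in> Lo" for f
      using that \<open>length xs = n\<close> by (auto simp: Lo_def f b_def field_simps)
    moreover have "f (xs @ [y]) \<le> 0 \<longleftrightarrow> y \<le> b f xs" if "f \<in> Up" for f
      using that \<open>length xs = n\<close> by (auto simp: Up_def f b_def field_simps)
    moreover have "f (xs @ [y]) \<le> 0 \<longleftrightarrow> g f xs \<le> 0" if "f \<in> Ze" for f
      using that \<open>length xs = n\<close> by (auto simp: Ze_def f)
    ultimately show ?thesis using P[of "xs @ [y]"] that sub(4) by auto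
  qed
  define Q where "Q xs \<longleftrightarrow> (\<forall>f\<in>Ze. g f xs \<le> 0) \<and> (\<forall>l\<in>Lo. \<forall>u\<in>Up. b l xs \<le> b u xs)" for xs
  have Q: "polyhedral n Q"
    unfolding Q_def using sub fins
    by (intro polyhedral_conj polyhedral_Ball polyhedral_le rational_affine_const g b) auto
  \<comment> \<open>The fallback is the least upper bound, written as a negated maximum so that
    \<open>real_computable_Max\<close> covers both cases. The outer case distinction concerns
    \<open>L\<close> alone, so it costs no comparison in the tree.\<close>
  define w where "w xs = (if Lo \<noteq> {} then Max ((\<lambda>f. b f xs) ` Lo)
    else if Up \<noteq> {} then - 1 * Max ((\<lambda>f. - 1 * b f xs) ` Up) else 0)" for xs
  have w: "real_computable n w"
    unfolding w_def using sub fins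
    by (cases "Lo = {}"; cases "Up = {}";
        simp only: simp_thms if_True if_False;
        intro real_computable_Max real_computable_mult real_computable_Rats
          real_computable_rational_affine b) auto
  have Q_if: "Q xs" if "length xs = n" "P (xs @ [y])" for xs y
    using that P_iff[OF that(1), of y] unfolding Q_def by (auto intro: order_trans)
  have P_w: "P (xs @ [w xs])" if "length xs = n" "Q xs" for xs
  proof -
    have "b f xs \<le> w xs" if "f \<in> Lo" for f
      using that fins by (auto simp: w_def)
    moreover have "w xs \<le> b f xs" if "f \<in> Up" for f
    proof (cases "Lo = {}")
      case True
      have "- 1 * b f xs \<le> Max ((\<lambda>f. - 1 * b f xs) ` Up)"
        using that fins by (intro Max_ge) auto
      then show ?thesis using True that by (auto simp: w_def)
    next
      case False
      then show ?thesis using \<open>Q xs\<close> that fins by (simp add: w_def Q_def)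
    qed
    ultimately show ?thesis using that P_iff by (auto simp: Q_def)
  qed
  show thesis
  proof
    show "polyhedral n (\<lambda>xs. \<exists>y. P (xs @ [y]))"
      using Q by (rule polyhedral_cong) (use Q_if P_w in blast)
    show "real_computable n w" by (rule w)
    show "P (xs @ [w xs])" if "length xs = n" "\<exists>y. P (xs @ [y])" for xs
      using that Q_if P_w by blast
    show "w xs \<le> y" if len: "length xs = n" and pos: "\<And>y. P (xs @ [y]) \<Longrightarrow> 0 \<le> y" and "P (xs @ [y])" for xs y
    proof (cases "Lo = {}")
      case True
      \<comment> \<open>Upper bounds survive when \<open>y\<close> is lowered, so a negative
        solution would exist.\<close>
      then have "P (xs @ [min y (- 1)])"
        using \<open>P (xs @ [y])\<close> P_iff[OF len] by (auto simp: min_le_iff_disj)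
      from pos[OF this] show ?thesis by simp
    next
      case False
      then show ?thesis using \<open>P (xs @ [y])\<close> P_iff[OF len] fins by (simp add: w_def)
    qed
  qed
qed

text \<open>Variables are eliminated from the end of the list. The witness is recovered by back
  substitution: the value of the last variable is computed from the inputs together with the
  witnesses already found for the earlier variables.\<close>

lemma polyhedral_projection:
  assumes "polyhedral (n + m) P"
  shows "polyhedral n (\<lambda>xs. \<exists>ys. length ys = m \<and> P (xs @ ys))"
    and "\<exists>F. computable n F \<and> (\<forall>xs. length xs = n \<longrightarrow> length (F xs) = m \<and>
      ((\<exists>ys. length ys = m \<and> P (xs @ ys)) \<longrightarrow> P (xs @ F xs)))"
proof -
  have "polyhedral n (\<lambda>xs. \<exists>ys. length ys = m \<and> P (xs @ ys)) \<and>
    (\<exists>F. computable n F \<and> (\<forall>xs. length xs = n \<longrightarrow> length (F xs) = m \<and>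
      ((\<exists>ys. length ys = m \<and> P (xs @ ys)) \<longrightarrow> P (xs @ F xs))))"
    using assms
  proof (induction m arbitrary: P)
    case 0
    then show ?case by (auto intro!: exI[of _ "\<lambda>_. []"] computable_Nil)
  next
    case (Suc m)
    then have "polyhedral (Suc (n + m)) P" by simp
    then obtain w where poly: "polyhedral (n + m) (\<lambda>xs. \<exists>y. P (xs @ [y]))"
      and w: "real_computable (n + m) w"
      and Pw: "\<And>xs. length xs = n + m \<Longrightarrow> \<exists>y. P (xs @ [y]) \<Longrightarrow> P (xs @ [w xs])"
      by (rule polyhedral_eliminate) blast
    have eq: "(\<exists>ys. length ys = Suc m \<and> P (xs @ ys)) \<longleftrightarrow>
      (\<exists>ys. length ys = m \<and> (\<exists>y. P ((xs @ ys) @ [y])))" for xs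
      by (auto simp: length_Suc_conv_rev)
    obtain F where F: "computable n F" "\<And>xs. length xs = n \<Longrightarrow> length (F xs) = m"
      "\<And>xs. length xs = n \<Longrightarrow> \<exists>ys. length ys = m \<and> (\<exists>y. P ((xs @ ys) @ [y])) \<Longrightarrow>
         \<exists>y. P ((xs @ F xs) @ [y])"
      using Suc.IH[OF poly] by blast
    let ?F = "\<lambda>xs. F xs @ [w (xs @ F xs)]"
    have "real_computable n (\<lambda>xs. w (xs @ F xs))"
      by (rule computable_compose[where f = "\<lambda>xs. xs @ F xs"], rule computable_append[OF computable_id F(1)], simp add: F(2), rule w)
    then have "computable n ?F"
      by (rule computable_append[OF F(1)])
    moreover have "length (?F xs) = Suc m \<and>
      ((\<exists>ys. length ys = Suc m \<and> P (xs @ ys)) \<longrightarrow> P (xs @ ?F xs))" if "length xs = n" for xs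
      using F(2,3)[OF that] Pw[of "xs @ F xs"] that unfolding eq by simp
    ultimately show ?case
      using Suc.IH[OF poly] unfolding eq by blast
  qed
  then show "polyhedral n (\<lambda>xs. \<exists>ys. length ys = m \<and> P (xs @ ys))"
    and "\<exists>F. computable n F \<and> (\<forall>xs. length xs = n \<longrightarrow> length (F xs) = m \<and>
      ((\<exists>ys. length ys = m \<and> P (xs @ ys)) \<longrightarrow> P (xs @ F xs)))" by blast+
qed

text \<open>The objective is the first unknown, \<open>ys ! 0\<close>. Feasibility has to be
  decidable because \<open>F xs\<close> carries no information when the program is infeasible, and
  the comparison of two programs must not select such a value.\<close>

definition minimizable :: "nat \<Rightarrow> nat \<Rightarrow> (real list \<Rightarrow> bool) \<Rightarrow> bool" where
  "minimizable n m S \<longleftrightarrow> decidable n (\<lambda>xs. \<exists>ys. length ys = m \<and> S (xs @ ys)) \<and>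
     (\<exists>F. computable n F \<and> (\<forall>xs. length xs = n \<longrightarrow> length (F xs) = m \<and>
        (\<forall>ys. length ys = m \<longrightarrow> S (xs @ ys) \<longrightarrow> S (xs @ F xs) \<and> F xs ! 0 \<le> ys ! 0)))"

lemma minimizableE:
  assumes "minimizable n m S"
  obtains F where "computable n F" "\<And>xs. length xs = n \<Longrightarrow> length (F xs) = m"
    "\<And>xs ys. length xs = n \<Longrightarrow> length ys = m \<Longrightarrow> S (xs @ ys) \<Longrightarrow> S (xs @ F xs) \<and> F xs ! 0 \<le> ys ! 0"
  using assms unfolding minimizable_def by blast

lemma minimizable_polyhedral:
  assumes "polyhedral (n + Suc m) P"
    and nonneg: "\<And>xs ys. length xs = n \<Longrightarrow> length ys = Suc m \<Longrightarrow> P (xs @ ys) \<Longrightarrow> 0 \<le> ys ! 0"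
  shows "minimizable n (Suc m) P"
proof -
  let ?Q = "\<lambda>xs. \<exists>ys. length ys = m \<and> P (xs @ ys)"
  \<comment> \<open>The objective is regrouped with the inputs, so that it is the last unknown to be
    eliminated and its least feasible value can be read off.\<close>
  have P': "polyhedral (Suc n + m) P" using assms by simp
  obtain F where F: "computable (Suc n) F" "\<And>xs. length xs = Suc n \<Longrightarrow> length (F xs) = m"
    "\<And>xs. length xs = Suc n \<Longrightarrow> ?Q xs \<Longrightarrow> P (xs @ F xs)"
    using polyhedral_projection(2)[OF P'] by blast
  obtain w where w: "real_computable n w"
    and Qw: "\<And>xs. length xs = n \<Longrightarrow> \<exists>y. ?Q (xs @ [y]) \<Longrightarrow> ?Q (xs @ [w xs])"
    and min: "\<And>xs y. length xs = n \<Longrightarrow> (\<And>y. ?Q (xs @ [y]) \<Longrightarrow> 0 \<le> y) \<Longrightarrow> ?Q (xs @ [y]) \<Longrightarrow> w xs \<le> y"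
    by (rule polyhedral_eliminate[OF polyhedral_projection(1)[OF P']]) blast
  let ?F = "\<lambda>xs. [w xs] @ F (xs @ [w xs])"
  have "computable n ?F"
    using F w by (intro computable_append computable_compose[where f = "\<lambda>xs. xs @ [w xs]" and g = F] computable_id) auto
  moreover have "P (xs @ ?F xs) \<and> ?F xs ! 0 \<le> ys ! 0"
    if xs: "length xs = n" and ys: "length ys = Suc m" "P (xs @ ys)" for xs ys
  proof -
    obtain y zs where "ys = y # zs" "length zs = m"
      using ys(1) by (auto simp: length_Suc_conv)
    then have y: "?Q (xs @ [ys ! 0])" using ys by auto
    have "0 \<le> y" if "?Q (xs @ [y])" for y
      using that nonneg[OF xs, of "y # _"] by auto
    then have "w xs \<le> ys ! 0" using min[OF xs] y by blast
    moreover have "P ((xs @ [w xs]) @ F (xs @ [w xs]))"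
      using F(3)[of "xs @ [w xs]"] Qw[OF xs] y xs by fastforce
    ultimately show ?thesis by simp
  qed
  ultimately show ?thesis
    unfolding minimizable_def using F(2)
    by (intro conjI decidable_polyhedral[OF polyhedral_projection(1)[OF assms(1)]] exI[of _ ?F]) auto
qed

lemma minimizable_disj:
  assumes "minimizable n m S" "minimizable n m S'"
  shows "minimizable n m (\<lambda>zs. S zs \<or> S' zs)" (is "minimizable n m ?T")
\<comment> \<open>With no unknowns there is no objective coordinate to compute; the empty list is
  the only candidate.\<close>
proof (cases "m = 0")
  case True
  then show ?thesis using assms decidable_disj unfolding minimizable_def
    by (auto intro!: exI[of _ "\<lambda>_. []"] computable_Nil)
next
  case False
  let ?D = "\<lambda>S xs. \<exists>ys. length ys = m \<and> S (xs @ ys)"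
  obtain F G where F: "computable n F" "\<And>xs. length xs = n \<Longrightarrow> length (F xs) = m"
      "\<And>xs ys. length xs = n \<Longrightarrow> length ys = m \<Longrightarrow> S (xs @ ys) \<Longrightarrow> S (xs @ F xs) \<and> F xs ! 0 \<le> ys ! 0"
    and G: "computable n G" "\<And>xs. length xs = n \<Longrightarrow> length (G xs) = m"
      "\<And>xs ys. length xs = n \<Longrightarrow> length ys = m \<Longrightarrow> S' (xs @ ys) \<Longrightarrow> S' (xs @ G xs) \<and> G xs ! 0 \<le> ys ! 0"
    by (rule minimizableE[OF assms(1)], rule minimizableE[OF assms(2)]) blast
  have D: "decidable n (?D S)" "decidable n (?D S')"
    using assms by (auto simp: minimizable_def)
  have hd: "real_computable n (\<lambda>xs. F xs ! 0)" "real_computable n (\<lambda>xs. G xs ! 0)"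
    using computable_compose[OF F(1,2) real_computable_nth[of 0 m]]
      computable_compose[OF G(1,2) real_computable_nth[of 0 m]] False by auto
  \<comment> \<open>\<open>F\<close> is chosen only if \<open>S\<close> is feasible and
    \<open>S'\<close> is either infeasible or not better.\<close>
  let ?c = "\<lambda>xs. ?D S xs \<and> (\<not> ?D S' xs \<or> F xs ! 0 \<le> G xs ! 0)"
  let ?H = "\<lambda>xs. if ?c xs then F xs else G xs"
  have "decidable n ?c"
    by (intro decidable_conj decidable_disj decidable_not D decidable_le hd)
  then have "computable n ?H"
    using F G by (intro computable_if) auto
  moreover have "?T (xs @ ?H xs) \<and> ?H xs ! 0 \<le> ys ! 0"
    if "length xs = n" "length ys = m" "?T (xs @ ys)" for xs ys
    using F(3)[OF that(1)] G(3)[OF that(1)] that by (smt (verit))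
  moreover have "decidable n (?D ?T)"
    by (rule decidable_cong[OF decidable_disj[OF D]]) blast
  ultimately show ?thesis
    unfolding minimizable_def using F(2) G(2)
    by (intro conjI exI[of _ ?H]) auto
qed

lemma minimizable_Bex:
  assumes "finite H" "\<And>h. h \<in> H \<Longrightarrow> minimizable n m (S h)"
  shows "minimizable n m (\<lambda>zs. \<exists>h\<in>H. S h zs)"
  using assms
proof (induction H rule: finite_induct)
  case empty
  have "computable n (\<lambda>_. replicate m 0)"
    using computable_map[of "replicate m (\<lambda>_. 0)" n] by (simp add: real_computable_Rats)
  then show ?case
    unfolding minimizable_def using decidable_const[of n False] by auto
qed (simp add: minimizable_disj)



section \<open>Piecewise linear trajectories\<close>

lemma l1_nonneg: "0 \<le> l1 p"
  by (simp add: l1_def)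

lemma l1_eq_0_iff: "l1 p = 0 \<longleftrightarrow> p = 0"
  by (auto simp: l1_def prod_eq_iff add_nonneg_eq_0_iff)

lemma l1_scaleR: "l1 (c *\<^sub>R p) = \<bar>c\<bar> * l1 p"
  by (simp add: l1_def abs_mult distrib_left)

lemma l1_triangle: "l1 (p + q) \<le> l1 p + l1 q"
  by (simp add: l1_def)

lemma l1_minus_commute: "l1 (p - q) = l1 (q - p)"
  by (simp add: l1_def abs_minus_commute)

lemma norm_le_l1: "norm p \<le> l1 p"
  using sqrt_sum_squares_le_sum_abs[of "fst p" "snd p"] by (simp add: l1_def norm_prod_def)

text \<open>Since \<open>l1\<close> is nonnegative, this also forces the times to be nondecreasing,
  and equal times force equal positions.\<close>

abbreviation speed_ok :: "real \<times> point \<Rightarrow> real \<times> point \<Rightarrow> bool" where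
  "speed_ok \<equiv> \<lambda>(s, p) (s', p'). l1 (p' - p) \<le> s' - s"

lemma speed_okD:
  assumes "speed_ok (s, p) (s', p')"
  shows "s \<le> s'" and "s = s' \<Longrightarrow> p = p'"
  using assms l1_nonneg[of "p' - p"] l1_eq_0_iff[of "p' - p"] by auto

lemma interp_hd:
  assumes "successively speed_ok ((s, p) # ws)"
  shows "interp ((s, p) # ws) s = p"
proof (cases ws)
  case (Cons w ws')
  then show ?thesis using assms speed_okD(1)[of s p "fst w" "snd w"] by (cases w) simp
qed simp

text \<open>At \<open>x = s'\<close> the code of \<open>interp\<close> still uses the first segment;
  its value there is \<open>p'\<close>, even when \<open>s = s'\<close>, because then
  \<open>p = p'\<close>.\<close>

lemma interp_Cons_eq:
  assumes "successively speed_ok ((s, p) # (s', p') # ws)" "s' \<le> x"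
  shows "interp ((s, p) # (s', p') # ws) x = interp ((s', p') # ws) x"
proof (cases "x = s'")
  case True
  have "interp ((s', p') # ws) s' = p'"
    using assms by (intro interp_hd) simp
  moreover have "p + ((s' - s) / (s' - s)) *\<^sub>R (p' - p) = p'"
    using speed_okD[of s p s' p'] assms by (cases "s = s'") auto
  ultimately show ?thesis using True by simp
qed (use assms in simp)

lemma successively_le_last:
  assumes "successively speed_ok ((s, p) # ws)"
  shows "s \<le> fst (last ((s, p) # ws))"
  using assms
proof (induction ws arbitrary: s p)
  case (Cons w ws)
  obtain s' p' where w: "w = (s', p')" by (cases w)
  then show ?case using Cons.IH[of s' p'] Cons.prems speed_okD(1)[of s p s' p'] by simp
qed simp

text \<open>Within one segment the displacement is the matching fraction of \<open>p' - p\<close>;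
  an interval that crosses \<open>s'\<close> is split there by the triangle inequality.\<close>

lemma interp_lipschitz:
  assumes "successively speed_ok ((s, p) # ws)" "s \<le> x" "x \<le> y"
  shows "l1 (interp ((s, p) # ws) y - interp ((s, p) # ws) x) \<le> y - x"
  using assms
proof (induction ws arbitrary: s p x)
  case Nil
  then show ?case by (simp add: l1_def)
next
  case (Cons w ws)
  obtain s' p' where w: "w = (s', p')" by (cases w)
  let ?I = "interp ((s, p) # (s', p') # ws)" and ?J = "interp ((s', p') # ws)"
  have suc: "successively speed_ok ((s, p) # (s', p') # ws)" and v: "l1 (p' - p) \<le> s' - s"
    and suc': "successively speed_ok ((s', p') # ws)"
    using Cons.prems w by auto
  have seg: "l1 (?I z - ?I x) \<le> z - x" if "x \<le> z" "z \<le> s'" for z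
  proof (cases "s = s'")
    case False
    then have "s < s'" using speed_okD(1)[of s p s' p'] v by simp
    have "?I z - ?I x = ((z - x) / (s' - s)) *\<^sub>R (p' - p)"
      using that by (simp add: algebra_simps diff_divide_distrib)
    then have "l1 (?I z - ?I x) = (z - x) / (s' - s) * l1 (p' - p)"
      using that \<open>s < s'\<close> by (simp add: l1_scaleR)
    also have "\<dots> \<le> (z - x) / (s' - s) * (s' - s)"
      using that \<open>s < s'\<close> v by (intro mult_left_mono) auto
    finally show ?thesis using \<open>s < s'\<close> by simp
  next
    case True
    then show ?thesis using that by (simp add: l1_def)
  qed
  have rest: "l1 (?I y - ?I z) \<le> y - z" if "s' \<le> z" "z \<le> y" for z
    using Cons.IH[OF suc' that] interp_Cons_eq[OF suc, of y] interp_Cons_eq[OF suc, of z] that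
    by (simp del: interp.simps)
  consider "y \<le> s'" | "s' \<le> x" | "x \<le> s'" "s' \<le> y" by linarith
  then show ?case
  proof cases
    case 3
    have "l1 (?I y - ?I x) \<le> l1 (?I y - ?I s') + l1 (?I s' - ?I x)"
      using l1_triangle[of "?I y - ?I s'" "?I s' - ?I x"] by simp
    then show ?thesis using seg[of s'] rest[of s'] 3 w by simp
  qed (use seg[of y] rest[of x] w Cons.prems in simp_all)
qed

lemma interp_image:
  assumes "successively speed_ok ((s, p) # ws)"
  shows "interp ((s, p) # ws) ` {s..fst (last ((s, p) # ws))} =
    {p} \<union> (\<Union>i<length ws. closed_segment (snd (((s, p) # ws) ! i)) (snd (ws ! i)))"
  using assms
proof (induction ws arbitrary: s p)
  case Nil
  then show ?case by simp
next
  case (Cons w ws)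
  obtain s' p' where w: "w = (s', p')" by (cases w)
  let ?I = "interp ((s, p) # (s', p') # ws)" and ?J = "interp ((s', p') # ws)"
  let ?l = "fst (last ((s', p') # ws))"
  have suc: "successively speed_ok ((s, p) # (s', p') # ws)" and v: "speed_ok (s, p) (s', p')"
    and suc': "successively speed_ok ((s', p') # ws)"
    using Cons.prems w by auto
  note D = speed_okD[OF v]
  have "?I ` {s..s'} = closed_segment p p'"
  proof (cases "s = s'")
    case True
    then show ?thesis using D by simp
  next
    case False
    have "?I ` {s..s'} = (\<lambda>u. p + u *\<^sub>R (p' - p)) ` (\<lambda>x. (x - s) / (s' - s)) ` {s..s'}"
      by (simp add: image_image)
    also have "(\<lambda>x. (x - s) / (s' - s)) ` {s..s'} = {0..1}"
    proof -
      have "u \<in> (\<lambda>x. (x - s) / (s' - s)) ` {s..s'}" if "u \<in> {0..1}" for u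
      proof (rule image_eqI)
        have "u * (s' - s) \<le> s' - s" "0 \<le> u * (s' - s)"
          using that D(1) by (auto intro: mult_left_le_one_le)
        then show "s + u * (s' - s) \<in> {s..s'}" by simp
      qed (use False in simp)
      then show ?thesis using False D by (auto simp: divide_simps)
    qed
    also have "(\<lambda>u. p + u *\<^sub>R (p' - p)) ` {0..1} = closed_segment p p'"
      by (simp add: closed_segment_image_interval algebra_simps)
    finally show ?thesis .
  qed
  moreover have "?I ` {s'..?l} = ?J ` {s'..?l}"
    by (intro image_cong refl interp_Cons_eq[OF suc]) simp
  moreover have "{s..?l} = {s..s'} \<union> {s'..?l}"
    using D successively_le_last[OF suc'] by auto
  ultimately have "?I ` {s..?l} = closed_segment p p' \<union> ?J ` {s'..?l}"
    by (simp only: image_Un)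
  then show ?case
    using Cons.IH[OF suc'] ends_in_segment[of p p']
    by (auto simp: w lessThan_Suc_eq_insert_0 image_image)
qed

lemma trajectory_interp:
  assumes "successively speed_ok ws" "ws \<noteq> []"
  shows "trajectory (fst (hd ws)) (fst (last ws)) (interp ws)"
proof -
  obtain s p vs where ws: "ws = (s, p) # vs"
    using assms(2) by (cases ws) auto
  have "l1 (interp ws x - interp ws y) \<le> \<bar>x - y\<bar>" if "s \<le> x" "s \<le> y" for x y
    using interp_lipschitz[of s p vs x y] interp_lipschitz[of s p vs y x] assms that
    by (cases "x \<le> y") (auto simp: ws l1_minus_commute)
  moreover have "polygonal_chain (interp ws ` {s..fst (last ws)})"
    unfolding polygonal_chain_def
  proof (intro exI conjI)
    have "(\<Union>i<length vs. closed_segment (snd (((s, p) # vs) ! i)) (snd (vs ! i))) =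
      (\<Union>i<length vs. closed_segment (map snd ws ! i) (map snd ws ! Suc i))"
      by (intro SUP_cong) (simp_all add: ws nth_Cons')
    then show "interp ws ` {s..fst (last ws)} = {map snd ws ! 0} \<union>
      (\<Union>i<length (map snd ws) - 1. closed_segment (map snd ws ! i) (map snd ws ! Suc i))"
      using interp_image[of s p vs] assms by (simp add: ws)
  qed (simp add: ws)
  ultimately show ?thesis
    unfolding trajectory_def by (simp add: ws)
qed

lemma interp_last:
  assumes "successively speed_ok ws" "ws \<noteq> []"
  shows "interp ws (fst (last ws)) = snd (last ws)"
  using assms
proof (induction ws rule: induct_list012)
  case (3 a b ws)
  obtain s p s' p' where ab: "a = (s, p)" "b = (s', p')" by (cases a, cases b)
  have "s' \<le> fst (last (b # ws))"
    using successively_le_last[of s' p' ws] "3.prems" by (simp add: ab)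
  then show ?case
    using interp_Cons_eq[of s p s' p' ws "fst (last (b # ws))"] "3.prems" "3.IH"(2)
    by (simp add: ab)
qed auto

text \<open>Both robots share their waypoint times, so at every instant they are at the same
  fraction \<open>u\<close> of the same segment. The relative position is therefore interpolated
  linearly too, which lets convexity act on it.\<close>

lemma interp_common_segment:
  fixes ws :: "(real \<times> point \<times> point) list"
  assumes "2 \<le> length ws" "fst (hd ws) \<le> x" "x \<le> fst (last ws)"
  shows "\<exists>i u. Suc i < length ws \<and> 0 \<le> u \<and> u \<le> 1 \<and>
    interp (map (\<lambda>(t, p, q). (t, p)) ws) x =
      fst (snd (ws ! i)) + u *\<^sub>R (fst (snd (ws ! Suc i)) - fst (snd (ws ! i))) \<and>
    interp (map (\<lambda>(t, p, q). (t, q)) ws) x =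
      snd (snd (ws ! i)) + u *\<^sub>R (snd (snd (ws ! Suc i)) - snd (snd (ws ! i)))"
  using assms
proof (induction ws rule: induct_list012)
  case (3 a b ws)
  obtain s p q s' p' q' where ab: "a = (s, p, q)" "b = (s', p', q')" by (cases a, cases b)
  show ?case
  proof (cases "x \<le> s'")
    case True
    then show ?thesis using "3.prems"
      by (intro exI[of _ 0] exI[of _ "(x - s) / (s' - s)"]) (auto simp: ab divide_simps)
  next
    case False
    then have "2 \<le> length (b # ws)"
      using "3.prems" by (cases ws) (auto simp: ab)
    then obtain i u where "Suc i < length (b # ws) \<and> 0 \<le> u \<and> u \<le> 1 \<and>
        interp (map (\<lambda>(t, p, q). (t, p)) (b # ws)) x =
          fst (snd ((b # ws) ! i)) + u *\<^sub>R (fst (snd ((b # ws) ! Suc i)) - fst (snd ((b # ws) ! i))) \<and>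
        interp (map (\<lambda>(t, p, q). (t, q)) (b # ws)) x =
          snd (snd ((b # ws) ! i)) + u *\<^sub>R (snd (snd ((b # ws) ! Suc i)) - snd (snd ((b # ws) ! i)))"
      using "3.IH"(2) "3.prems" False by (auto simp: ab)
    then show ?thesis using False
      by (intro exI[of _ "Suc i"] exI[of _ u]) (simp add: ab)
  qed
qed auto


section \<open>Reduction to parametric linear programs\<close>

text \<open>Starting in a set that contains \<open>a\<close>, jump to the last point
  \<open>c\<close> of that set. What follows \<open>c\<close> avoids it and is covered by one set
  fewer, so induction on the number of sets applies.\<close>

lemma closed_cover_chain:
  fixes a b :: real
  assumes "finite I" "card I \<le> k" "a \<le> b" "\<And>i. i \<in> I \<Longrightarrow> closed (C i)" "{a..b} \<subseteq> (\<Union>i\<in>I. C i)"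
  shows "\<exists>s h. s 0 = a \<and> s k = b \<and>
    (\<forall>j<k. s j \<le> s (Suc j) \<and> h j \<in> I \<and> s j \<in> C (h j) \<and> s (Suc j) \<in> C (h j))"
  using assms
proof (induction k arbitrary: a I)
  case 0
  then show ?case by auto
next
  case (Suc k)
  then obtain i where i: "i \<in> I" "a \<in> C i" by force
  define c where "c = Sup (C i \<inter> {a..b})"
  have "closed (C i \<inter> {a..b})" using Suc.prems i by (intro closed_Int) auto
  moreover have bdd: "bdd_above (C i \<inter> {a..b})" by (rule bdd_aboveI[of _ b]) auto
  ultimately have c: "c \<in> C i \<inter> {a..b}"
    unfolding c_def using i Suc.prems by (intro closed_contains_Sup) auto
  have after_c: "x \<notin> C i" if "x \<in> {c<..b}" for x
    using cSup_upper[OF _ bdd, of x] that c unfolding c_def[symmetric] by force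
  show ?case
  proof (cases "c = b")
    case True
    then show ?thesis using i c Suc.prems
      \<comment> \<open>If \<open>b\<close> is reached early, the remaining pieces are padded with
        length zero.\<close>
      by (intro exI[of _ "\<lambda>j. if j = 0 then a else b"] exI[of _ "\<lambda>_. i"]) auto
  next
    case False
    let ?U = "\<Union>j\<in>I - {i}. C j"
    have "{c<..b} \<subseteq> ?U"
    proof
      fix x assume x: "x \<in> {c<..b}"
      then have "x \<in> {a..b}" using c by simp
      then show "x \<in> ?U" using after_c[OF x] Suc.prems(5) by blast
    qed
    \<comment> \<open>A finite union of closed sets is closed, so it also contains \<open>c\<close>,
      where the next piece has to start.\<close>
    then have "closure {c<..b} \<subseteq> ?U"
      using Suc.prems by (intro closure_minimal closed_UN) auto
    then have "{c..b} \<subseteq> ?U"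
      using False c by (simp add: closure_greaterThanAtMost)
    moreover have "card (I - {i}) \<le> k"
      using Suc.prems i by simp
    ultimately obtain s h where "s 0 = c" "s k = b"
      "\<forall>j<k. s j \<le> s (Suc j) \<and> h j \<in> I - {i} \<and> s j \<in> C (h j) \<and> s (Suc j) \<in> C (h j)"
      using Suc.IH[of "I - {i}" c] Suc.prems c by auto
    then show ?thesis using i c
      by (intro exI[of _ "case_nat a s"] exI[of _ "case_nat i h"]) (auto split: nat.split)
  qed
qed

section \<open>Half-planes and plans\<close>

definition directions :: "point set" where
  "directions = {(1, 0), (-1, 0), (0, 1), (0, -1)}"

lemma linf_ge_1_iff: "1 \<le> linf d \<longleftrightarrow> (\<exists>u\<in>directions. 1 \<le> u \<bullet> d)"
  by (auto simp: directions_def linf_def inner_prod_def)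

lemma configs_2_iff: "P \<in> configs 2 \<longleftrightarrow> (\<exists>p q. P = [p, q] \<and> 1 \<le> linf (q - p))"
proof -
  have "linf (p - q) = linf (q - p)" for p q
    by (simp add: linf_def abs_minus_commute)
  then show ?thesis
    by (auto simp: configs_def length_Suc_conv numeral_2_eq_2 less_Suc_eq)
qed

text \<open>A plan is a list of 24 reals: the input (indices 0 to 7), the makespan (index 8), the times
  of the three intermediate waypoints (9 to 11), and the four coordinates of the two robots at each
  of them (12 to 23). Waypoints 0 and 4 are the start and the target.\<close>

definition way_time :: "real list \<Rightarrow> nat \<Rightarrow> real" where
  "way_time z k = (if k = 0 then 0 else if k = 4 then z ! 8 else z ! (8 + k))"

definition way_coord :: "real list \<Rightarrow> nat \<Rightarrow> nat \<Rightarrow> real" where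
  "way_coord z k j = (if k = 0 then z ! j else if k = 4 then z ! (4 + j) else z ! (8 + 4 * k + j))"

definition way_pos1 :: "real list \<Rightarrow> nat \<Rightarrow> point" where
  "way_pos1 z k = (way_coord z k 0, way_coord z k 1)"

definition way_pos2 :: "real list \<Rightarrow> nat \<Rightarrow> point" where
  "way_pos2 z k = (way_coord z k 2, way_coord z k 3)"

text \<open>The half-planes \<open>hs\<close> are a parameter and not entries of \<open>z\<close>:
  for fixed \<open>hs\<close> every condition is linear in \<open>z\<close>. One direction serves
  both ends of a piece, as convexity requires.\<close>

definition valid_plan :: "point list \<Rightarrow> real list \<Rightarrow> bool" where
  "valid_plan hs z \<longleftrightarrow> (\<forall>i\<in>{..<4}.
     l1 (way_pos1 z (Suc i) - way_pos1 z i) \<le> way_time z (Suc i) - way_time z i \<and>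
     l1 (way_pos2 z (Suc i) - way_pos2 z i) \<le> way_time z (Suc i) - way_time z i \<and>
     1 \<le> hs ! i \<bullet> (way_pos2 z i - way_pos1 z i) \<and>
     1 \<le> hs ! i \<bullet> (way_pos2 z (Suc i) - way_pos1 z (Suc i)))"

definition plan_types :: "point list set" where
  "plan_types = {hs. set hs \<subseteq> directions \<and> length hs = 4}"

lemma finite_plan_types: "finite plan_types"
  unfolding plan_types_def by (rule finite_lists_length_eq) (simp add: directions_def)

lemma rational_affine_way_time: "k \<le> 4 \<Longrightarrow> rational_affine 24 (\<lambda>z. way_time z k)"
  by (cases "k = 0"; cases "k = 4") (simp_all add: way_time_def rational_affine_nth rational_affine_const)

lemma rational_affine_way_coord: "k \<le> 4 \<Longrightarrow> j < 4 \<Longrightarrow> rational_affine 24 (\<lambda>z. way_coord z k j)"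
  by (cases "k = 0"; cases "k = 4") (simp_all add: way_coord_def rational_affine_nth)

text \<open>The \<open>l1\<close> ball is cut out by four inequalities, one for each choice of
  signs.\<close>

lemma polyhedral_l1_le:
  assumes "rational_affine n x" "rational_affine n y" "rational_affine n t"
  shows "polyhedral n (\<lambda>z. l1 (x z, y z) \<le> t z)"
proof -
  have "l1 (a, b) \<le> c \<longleftrightarrow> (a \<le> c - b \<and> a \<le> c + b) \<and> (b - c \<le> a \<and> - 1 * b - c \<le> a)" for a b c
    by (auto simp: l1_def)
  then show ?thesis
    by (simp only:) (intro polyhedral_conj polyhedral_le rational_affine_add rational_affine_diff
        rational_affine_cmult assms; simp)
qed

lemma polyhedral_valid_plan:
  assumes "hs \<in> plan_types"
  shows "polyhedral 24 (valid_plan hs)"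
proof -
  have rat: "fst (hs ! i) \<in> \<rat>" "snd (hs ! i) \<in> \<rat>" if "i < 4" for i
  proof -
    have "hs ! i \<in> directions"
      using assms that nth_mem[of i hs] by (auto simp: plan_types_def)
    then show "fst (hs ! i) \<in> \<rat>" "snd (hs ! i) \<in> \<rat>"
      by (auto simp: directions_def)
  qed
  show ?thesis
    unfolding valid_plan_def way_pos1_def way_pos2_def inner_prod_def inner_real_def
    by (simp only: fst_diff snd_diff fst_conv snd_conv diff_Pair)
      (intro polyhedral_Ball polyhedral_conj polyhedral_l1_le polyhedral_le rational_affine_const
        rational_affine_add rational_affine_diff rational_affine_cmult
        rational_affine_way_time rational_affine_way_coord rat; simp)
qed

text \<open>The speed bounds make the waypoint times nondecreasing from 0, so the makespan, first of
  the 16 unknowns, is bounded below as the minimization demands.\<close>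

lemma minimizable_valid_plan: "minimizable 8 16 (\<lambda>z. \<exists>hs\<in>plan_types. valid_plan hs z)"
proof (rule minimizable_Bex[OF finite_plan_types])
  fix hs assume "hs \<in> plan_types"
  have nonneg: "0 \<le> ys ! 0" if "length xs = 8" "valid_plan hs (xs @ ys)" for xs ys
  proof -
    let ?t = "way_time (xs @ ys)"
    have "?t i \<le> ?t (Suc i)" if "i < 4" for i
      using \<open>valid_plan hs (xs @ ys)\<close> that l1_nonneg unfolding valid_plan_def
      by (smt (verit) lessThan_iff)
    from this[of 0] this[of 1] this[of 2] this[of 3] have "?t 0 \<le> ?t 4"
      by (simp add: eval_nat_numeral)
    then show ?thesis using that(1) by (simp add: way_time_def nth_append)
  qed
  have "polyhedral (8 + Suc 15) (valid_plan hs)"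
    using polyhedral_valid_plan[OF \<open>hs \<in> plan_types\<close>] by simp
  from minimizable_polyhedral[OF this nonneg] show "minimizable 8 16 (valid_plan hs)"
    by simp
qed

text \<open>Packs waypoints into a list. It is applied to waypoints sampled from a schedule and to
  those of an explicit detour.\<close>

lemma plan_exists:
  fixes t :: "nat \<Rightarrow> real" and p q h :: "nat \<Rightarrow> point"
  assumes "t 0 = 0"
    and "\<And>i. i < 4 \<Longrightarrow> l1 (p (Suc i) - p i) \<le> t (Suc i) - t i"
    and "\<And>i. i < 4 \<Longrightarrow> l1 (q (Suc i) - q i) \<le> t (Suc i) - t i"
    and "\<And>i. i < 4 \<Longrightarrow> h i \<in> directions"
    and "\<And>i. i < 4 \<Longrightarrow> 1 \<le> h i \<bullet> (q i - p i)"
    and "\<And>i. i < 4 \<Longrightarrow> 1 \<le> h i \<bullet> (q (Suc i) - p (Suc i))"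
  shows "\<exists>ys. length ys = 16 \<and> ys ! 0 = t 4 \<and>
    (\<exists>hs\<in>plan_types. valid_plan hs (encode2 [p 0, q 0] [p 4, q 4] @ ys))"
proof -
  define ys where "ys = [t 4, t 1, t 2, t 3,
    fst (p 1), snd (p 1), fst (q 1), snd (q 1), fst (p 2), snd (p 2), fst (q 2), snd (q 2),
    fst (p 3), snd (p 3), fst (q 3), snd (q 3)]"
  let ?z = "encode2 [p 0, q 0] [p 4, q 4] @ ys"
  let ?hs = "map h [0..<4]"
  have way: "way_time ?z k = t k" "way_pos1 ?z k = p k" "way_pos2 ?z k = q k" if "k \<le> 4" for k
  proof -
    have "k \<in> {0, 1, 2, 3, 4}" using that by auto
    then show "way_time ?z k = t k" "way_pos1 ?z k = p k" "way_pos2 ?z k = q k"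
      using assms(1)
      by (auto simp: encode2_def ys_def way_time_def way_pos1_def way_pos2_def way_coord_def)
  qed
  have "valid_plan ?hs ?z"
    using assms unfolding valid_plan_def by (auto simp: way)
  moreover have "?hs \<in> plan_types"
    using assms by (auto simp: plan_types_def)
  ultimately show ?thesis
    by (intro exI[of _ ys]) (auto simp: ys_def)
qed

section \<open>From schedules to plans\<close>

lemma trajectory_continuous_on:
  assumes "trajectory a b m"
  shows "continuous_on {a..b} m"
proof -
  have "1-lipschitz_on {a..b} m"
    using assms order_trans[OF norm_le_l1] unfolding trajectory_def
    by (intro lipschitz_onI) (simp_all add: dist_norm)
  then show ?thesis by (rule lipschitz_on_continuous_on)
qed

lemma plan_of_schedule:
  assumes "feasible_schedule M t0 t1 A B" "length A = 2"
  shows "\<exists>ys. length ys = 16 \<and> ys ! 0 = t1 - t0 \<and>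
    (\<exists>hs\<in>plan_types. valid_plan hs (encode2 A B @ ys))"
proof -
  have "length M = Suc (Suc 0)"
    using assms by (simp add: feasible_schedule_def)
  then obtain m1 m2 where M: "M = [m1, m2]"
    by (auto simp: length_Suc_conv)
  have t: "t0 \<le> t1" and m: "trajectory t0 t1 m1" "trajectory t0 t1 m2"
    and AB: "A = [m1 t0, m2 t0]" "B = [m1 t1, m2 t1]"
    and free: "\<And>t. t \<in> {t0..t1} \<Longrightarrow> 1 \<le> linf (m2 t - m1 t)"
    using assms by (auto simp: feasible_schedule_def M configs_2_iff numeral_2_eq_2[symmetric])
  \<comment> \<open>The times at which the relative position lies in the half-plane of
    \<open>u\<close>; closed because trajectories are continuous.\<close>
  define C where "C u = {t0..t1} \<inter> (\<lambda>t. u \<bullet> (m2 t - m1 t)) -` {1..}" for u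
  have "closed (C u)" for u
    unfolding C_def using m
    by (intro continuous_closed_preimage continuous_intros trajectory_continuous_on) auto
  moreover have "{t0..t1} \<subseteq> (\<Union>u\<in>directions. C u)"
    using free linf_ge_1_iff by (fastforce simp: C_def)
  moreover have "finite directions" "card directions \<le> 4"
    by (auto simp: directions_def card_insert_if)
  ultimately obtain s h where s: "s 0 = t0" "s 4 = t1"
    and sh: "\<And>j. j < 4 \<Longrightarrow> s j \<le> s (Suc j) \<and> h j \<in> directions \<and> s j \<in> C (h j) \<and> s (Suc j) \<in> C (h j)"
    using closed_cover_chain[of directions 4 t0 t1 C] t by blast
  have "l1 (m (s (Suc j)) - m (s j)) \<le> s (Suc j) - s j" if "j < 4" "trajectory t0 t1 m" for j m
  proof -
    have "s (Suc j) \<in> {t0..t1}" "s j \<in> {t0..t1}" "s j \<le> s (Suc j)"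
      using sh[OF that(1)] by (auto simp: C_def)
    then show ?thesis using that(2) unfolding trajectory_def by fastforce
  qed
  then show ?thesis
    using plan_exists[of "\<lambda>k. s k - t0" "\<lambda>k. m1 (s k)" "\<lambda>k. m2 (s k)" h] s sh m
    by (simp add: AB C_def)
qed

text \<open>Supplies feasibility only, with no care for the makespan. A direction \<open>w\<close>
  at no obtuse angle to \<open>u\<close> and \<open>v\<close> always exists: a perpendicular one if
  they are opposite, \<open>u\<close> itself otherwise. The relative position then moves through
  \<open>u + w\<close> and \<open>w + v\<close>, which lie in the half-planes of \<open>u\<close>
  and \<open>w\<close>, and of \<open>w\<close> and \<open>v\<close>.\<close>

lemma plan_for_configs:
  assumes "A \<in> configs 2" "B \<in> configs 2"
  shows "\<exists>ys. length ys = 16 \<and> (\<exists>hs\<in>plan_types. valid_plan hs (encode2 A B @ ys))"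
proof -
  obtain a1 a2 b1 b2 u v where AB: "A = [a1, a2]" "B = [b1, b2]"
    and uv: "u \<in> directions" "v \<in> directions" "1 \<le> u \<bullet> (a2 - a1)" "1 \<le> v \<bullet> (b2 - b1)"
    using assms by (auto simp: configs_2_iff linf_ge_1_iff)
  obtain w where w: "w \<in> directions" "0 \<le> u \<bullet> w" "0 \<le> v \<bullet> w"
  proof -
    have "\<exists>w\<in>directions. 0 \<le> u \<bullet> w \<and> 0 \<le> v \<bullet> w"
      using uv(1,2) unfolding directions_def by (auto simp: inner_prod_def)
    then show thesis using that by blast
  qed
  have unit: "d \<bullet> d = 1" if "d \<in> directions" for d
    using that by (auto simp: directions_def inner_prod_def)
  \<comment> \<open>The first robot waits at the origin at the two middle waypoints; the last piece
    is idle, as three moves suffice.\<close>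
  define p where "p k = [a1, 0, 0, b1, b1] ! k" for k
  define q where "q k = [a2, u + w, w + v, b2, b2] ! k" for k
  define h where "h k = [u, w, v, v] ! k" for k
  \<comment> \<open>A time allowance long enough for any single piece, given to each of the
    four.\<close>
  define c where "c = (\<Sum>i<4. l1 (p (Suc i) - p i) + l1 (q (Suc i) - q i))"
  have le_c: "l1 (p (Suc i) - p i) + l1 (q (Suc i) - q i) \<le> c" if "i < 4" for i
    unfolding c_def using that l1_nonneg
    by (intro member_le_sum[of i "{..<4}" "\<lambda>i. l1 (p (Suc i) - p i) + l1 (q (Suc i) - q i)"]) auto
  have less_4: "i = 0 \<or> i = 1 \<or> i = 2 \<or> i = 3" if "i < 4" for i :: nat
    using that by linarith
  have h: "h i \<in> directions \<and> 1 \<le> h i \<bullet> (q i - p i) \<and> 1 \<le> h i \<bullet> (q (Suc i) - p (Suc i))" if "i < 4" for i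
    using less_4[OF that] uv(3,4) w(2,3) unit[OF uv(1)] unit[OF uv(2)] unit[OF w(1)]
    by (elim disjE) (simp_all add: p_def q_def h_def inner_add_right inner_commute[of w u] inner_commute[of w v] uv(1,2) w(1))
  have "\<exists>ys. length ys = 16 \<and> ys ! 0 = real 4 * c \<and>
      (\<exists>hs\<in>plan_types. valid_plan hs (encode2 [p 0, q 0] [p 4, q 4] @ ys))"
  proof (rule plan_exists[of "\<lambda>k. real k * c" p q h])
    fix i :: nat assume "i < 4"
    then show "l1 (p (Suc i) - p i) \<le> real (Suc i) * c - real i * c"
      "l1 (q (Suc i) - q i) \<le> real (Suc i) * c - real i * c"
      using le_c[of i] l1_nonneg[of "p (Suc i) - p i"] l1_nonneg[of "q (Suc i) - q i"]
      by (simp_all add: distrib_right)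
  qed (use h in auto)
  then show ?thesis by (auto simp: AB p_def q_def)
qed

section \<open>From plans to schedules\<close>

definition plan_output :: "real list \<Rightarrow> real list" where
  "plan_output z = z ! 8 # concat (map (\<lambda>k. way_time z k #
     map (way_coord z k) [0..<4]) [0..<5])"

lemma waypoints2_plan_output:
  "waypoints2 (tl (plan_output z)) = map (\<lambda>k. (way_time z k, way_pos1 z k, way_pos2 z k)) [0..<5]"
  by (simp add: plan_output_def way_pos1_def way_pos2_def upt_rec numeral_2_eq_2 numeral_3_eq_3)

lemma computable_plan_output: "computable 24 plan_output"
proof -
  let ?fs = "(\<lambda>z. way_time z 4) # concat (map (\<lambda>k. (\<lambda>z. way_time z k) #
     map (\<lambda>j z. way_coord z k j) [0..<4]) [0..<5])"
  have "computable 24 (\<lambda>z. map (\<lambda>f. f z) ?fs)"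
    by (rule computable_map)
      (auto intro!: real_computable_rational_affine rational_affine_way_time rational_affine_way_coord)
  then show ?thesis
    by (rule computable_cong) (simp add: plan_output_def way_time_def map_concat comp_def)
qed

lemma feasible_plan_output:
  assumes "hs \<in> plan_types" "valid_plan hs (encode2 A B @ ys)" "length A = 2" "length B = 2"
  defines "z \<equiv> encode2 A B @ ys"
  shows "feasible_schedule (out_schedule (plan_output z)) (out_t0 (plan_output z)) (out_t1 (plan_output z)) A B"
proof -
  let ?W = "map (\<lambda>k. (way_time z k, way_pos1 z k, way_pos2 z k)) [0..<5]"
  let ?W1 = "map (\<lambda>k. (way_time z k, way_pos1 z k)) [0..<5]"
  let ?W2 = "map (\<lambda>k. (way_time z k, way_pos2 z k)) [0..<5]"
  note W = waypoints2_plan_output[of z]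
  have upt5: "[0..<5] = [0, 1, 2, 3, 4]" by (simp add: upt_rec)
  have t01: "out_t0 (plan_output z) = 0" "out_t1 (plan_output z) = way_time z 4"
    by (simp_all add: out_t0_def out_t1_def W upt5 way_time_def)
  have M: "out_schedule (plan_output z) = [interp ?W1, interp ?W2]"
    by (simp add: out_schedule_def W comp_def)
  have valid: "l1 (way_pos1 z (Suc i) - way_pos1 z i) \<le> way_time z (Suc i) - way_time z i"
    "l1 (way_pos2 z (Suc i) - way_pos2 z i) \<le> way_time z (Suc i) - way_time z i"
    "1 \<le> hs ! i \<bullet> (way_pos2 z i - way_pos1 z i)"
    "1 \<le> hs ! i \<bullet> (way_pos2 z (Suc i) - way_pos1 z (Suc i))" if "i < 4" for i
    using assms(2) that unfolding z_def valid_plan_def by auto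
  have suc: "successively speed_ok ?W1" "successively speed_ok ?W2"
    using valid[of 0] valid[of 1] valid[of 2] valid[of 3]
    by (simp_all add: upt5 eval_nat_numeral)
  have hd_last: "hd ?W1 = (0, way_pos1 z 0)" "last ?W1 = (way_time z 4, way_pos1 z 4)"
    "hd ?W2 = (0, way_pos2 z 0)" "last ?W2 = (way_time z 4, way_pos2 z 4)"
    by (simp_all add: upt5 way_time_def)
  have AB: "A = [way_pos1 z 0, way_pos2 z 0]" "B = [way_pos1 z 4, way_pos2 z 4]"
    using assms(3,4)
    by (auto simp: z_def encode2_def way_pos1_def way_pos2_def way_coord_def length_Suc_conv numeral_2_eq_2 numeral_3_eq_3)
  have traj: "trajectory 0 (way_time z 4) (interp ?W1)" "trajectory 0 (way_time z 4) (interp ?W2)"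
    using trajectory_interp[OF suc(1)] trajectory_interp[OF suc(2)] hd_last by simp_all
  have start: "interp ?W1 0 = way_pos1 z 0" "interp ?W2 0 = way_pos2 z 0"
    using interp_hd[of 0 "way_pos1 z 0" "tl ?W1"] interp_hd[of 0 "way_pos2 z 0" "tl ?W2"] suc
    by (simp_all add: upt5 way_time_def)
  have target: "interp ?W1 (way_time z 4) = way_pos1 z 4" "interp ?W2 (way_time z 4) = way_pos2 z 4"
    using interp_last[OF suc(1)] interp_last[OF suc(2)] hd_last by simp_all
  have free: "1 \<le> linf (interp ?W2 x - interp ?W1 x)" if "0 \<le> x" "x \<le> way_time z 4" for x
  proof -
    have *: "\<exists>i u. Suc i < length ?W \<and> 0 \<le> u \<and> u \<le> 1 \<and>
        interp (map (\<lambda>(t, p, q). (t, p)) ?W) x =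
          fst (snd (?W ! i)) + u *\<^sub>R (fst (snd (?W ! Suc i)) - fst (snd (?W ! i))) \<and>
        interp (map (\<lambda>(t, p, q). (t, q)) ?W) x =
          snd (snd (?W ! i)) + u *\<^sub>R (snd (snd (?W ! Suc i)) - snd (snd (?W ! i)))"
      by (rule interp_common_segment) (use that in \<open>simp_all add: upt5 way_time_def\<close>)
    obtain i u where i: "i < 4" and u: "0 \<le> u" "u \<le> 1"
      and eq: "interp ?W1 x = way_pos1 z i + u *\<^sub>R (way_pos1 z (Suc i) - way_pos1 z i)"
        "interp ?W2 x = way_pos2 z i + u *\<^sub>R (way_pos2 z (Suc i) - way_pos2 z i)"
      using * by (auto simp: comp_def simp del: upt_Suc)
    \<comment> \<open>The relative position is a convex combination of its values at the two ends of
      piece \<open>i\<close>, both in the half-plane of \<open>hs ! i\<close>.\<close>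
    have "hs ! i \<bullet> (interp ?W2 x - interp ?W1 x) =
      (1 - u) * (hs ! i \<bullet> (way_pos2 z i - way_pos1 z i)) +
      u * (hs ! i \<bullet> (way_pos2 z (Suc i) - way_pos1 z (Suc i)))"
      unfolding eq by (simp add: inner_diff_right inner_add_right algebra_simps)
    also have "\<dots> \<ge> (1 - u) * 1 + u * 1"
      using valid(3,4)[OF i] u by (intro add_mono mult_left_mono) auto
    finally have "1 \<le> hs ! i \<bullet> (interp ?W2 x - interp ?W1 x)" by simp
    moreover have "hs ! i \<in> directions"
      using assms(1) i nth_mem[of i hs] by (auto simp: plan_types_def)
    ultimately show ?thesis using linf_ge_1_iff by blast
  qed
  have "0 \<le> way_time z 4"
    using successively_le_last[of 0 "way_pos1 z 0" "tl ?W1"] suc(1) by (simp add: upt5 way_time_def)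
  then show ?thesis
    unfolding feasible_schedule_def M t01
    using traj start target free by (simp add: AB configs_2_iff numeral_2_eq_2[symmetric])
qed

theorem theorem3p3:
  shows "\<exists>T :: ctree. solves_minmakespan2 T"
proof -
  let ?S = "\<lambda>z. \<exists>hs\<in>plan_types. valid_plan hs z"
  obtain F where F: "computable 8 F" "\<And>xs. length xs = 8 \<Longrightarrow> length (F xs) = 16"
    "\<And>xs ys. length xs = 8 \<Longrightarrow> length ys = 16 \<Longrightarrow> ?S (xs @ ys) \<Longrightarrow> ?S (xs @ F xs) \<and> F xs ! 0 \<le> ys ! 0"
    by (rule minimizableE[OF minimizable_valid_plan]) blast
  have "computable 8 (\<lambda>xs. plan_output (xs @ F xs))"
    by (rule computable_compose[where f = "\<lambda>xs. xs @ F xs",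
          OF computable_append[OF computable_id F(1)] _ computable_plan_output]) (simp add: F(2))
  then obtain T where T: "\<And>xs. length xs = 8 \<Longrightarrow> eval_ctree xs T = Some (plan_output (xs @ F xs))"
    by (rule computableE) blast
  have "solves_minmakespan2 T"
    unfolding solves_minmakespan2_def
  proof (intro ballI)
    fix A B assume AB: "A \<in> configs 2" "B \<in> configs 2"
    let ?xs = "encode2 A B"
    let ?out = "plan_output (?xs @ F ?xs)"
    have len: "length A = 2" "length B = 2" "length ?xs = 8"
      using AB by (auto simp: configs_2_iff encode2_def)
    have hd_out: "hd ?out = F ?xs ! 0"
      by (simp add: plan_output_def nth_append len)
    have times: "hd ?out = out_t1 ?out - out_t0 ?out"
      by (simp add: out_t1_def out_t0_def waypoints2_plan_output upt_rec way_time_def plan_output_def)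
    have "?S (?xs @ F ?xs)"
      using plan_for_configs[OF AB] F(3)[OF len(3)] by blast
    then have "feasible_schedule (out_schedule ?out) (out_t0 ?out) (out_t1 ?out) A B"
      using feasible_plan_output len by blast
    \<comment> \<open>Every competing schedule gives a plan of the same makespan, and
      \<open>F\<close> is at least as good as any plan.\<close>
    moreover have "hd ?out \<le> t1 - t0" if "feasible_schedule M t0 t1 A B" for M t0 t1
      using plan_of_schedule[OF that len(1)] F(3)[OF len(3)] unfolding hd_out by metis
    moreover have "?out \<noteq> []" by (simp add: plan_output_def)
    moreover have "waypoints2 (tl ?out) \<noteq> []" by (simp add: waypoints2_plan_output)
    ultimately show "\<exists>out. eval_ctree ?xs T = Some out \<and> out \<noteq> [] \<and> waypoints2 (tl out) \<noteq> [] \<and>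
        feasible_schedule (out_schedule out) (out_t0 out) (out_t1 out) A B \<and>
        hd out = out_t1 out - out_t0 out \<and>
        (\<forall>M t0 t1. feasible_schedule M t0 t1 A B \<longrightarrow> hd out \<le> t1 - t0)"
      using T[OF len(3)] times by blast
  qed
  then show ?thesis by blast
qed

end
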